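(* Let $N\ge1$ be an integer and let $\lambda_1,\lambda_2,\mu_1,\mu_2>0$ satisfy $\lambda_1\ne\mu_1$, $\lambda_2\neq\mu_2$ and $\lambda_1+\lambda_2+\mu_1+\mu_2\le1$. Put $\rho_1=\lambda_1/\mu_1$ and $\rho_2=\lambda_2/\mu_2$. Let $X$ be the random walk on the square lattice $\mathbb{E}=\{0,\ldots,N\}^2$ which from $(x,y)$ moves to $(x+1,y)$ with probability $\lambda_1$, to $(x-1,y)$ with probability $\mu_1$, to $(x,y+1)$ with probability $\lambda_2$, to $(x,y-1)$ with probability $\mu_2$ (each move only if the target lies in $\mathbb{E}$), and stays at $(x,y)$ with the remaining probability. Assume that $X$ starts at $(0,0)$. Then there exists a sharp strong stationary dual chain $X^*$ for $X$, which is an absorbing Markov chain on the state space $\mathbb{E}^*=\mathbb{E}=\{0,\ldots,N\}^2$ with $(N,N)$ the single absorbing state, starting at $(0,0)$, with the following transition probabilities (for $x,x',y,y'\in\{0,\ldots,N\}$): $$P^*((x,y),(x',y'))=\begin{cases} \frac{1-\rho_1^{x+2}}{1-\rho_1^{x+1}}\,\mu_1 & \text{if } x'=x+1,\ y'=y,\\[4pt] \frac{1-\rho_2^{y+2}}{1-\rho_2^{y+1}}\,\mu_2 & \text{if } y'=y+1,\ x'=x,\\[4pt] \frac{1-\rho_2^{y}}{1-\rho_2^{y+1}}\,\lambda_2 & \text{if } x'=x,\ y'=y-1,\ y\ne N,\\[4pt] \frac{1-\rho_1^{x}}{1-\rho_1^{x+1}}\,\lambda_1 & \text{if } y'=y,\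 x'=x-1,\ x\neq N,\\[4pt] 1-(\lambda_1+\lambda_2+\mu_1+\mu_2) & \text{if } x'=x,\ y'=y,\ (x,y)\in\{0,\ldots,N-1\}^2,\\[4pt] 1-(\lambda_1+\mu_1) & \text{if } x'=x,\ y'=y=N,\ x\in\{0,\ldots,N-1\},\\[4pt] 1-(\lambda_2+\mu_2) & \text{if } x'=x=N,\ y'=y,\ y\in\{0,\ldots,N-1\},\\[4pt] 1 & \text{if } x'=x=y'=y=N, \end{cases}$$ and all other transitions have probability $0$.
   Context: Strong stationary duality. Let $X$ be an ergodic Markov chain on a finite set $\mathbb{E}$ with transition matrix $P$, initial distribution $\nu$ and stationary distribution $\pi$. A Markov chain $X^*$ with state space $\mathbb{E}^*$, transition matrix $P^*$, initial distribution $\nu^*$ and an absorbing state $e_a^*$ is a strong stationary dual (SSD) chain for $X$ if there is a stochastic kernel (link) $\Lambda(e^*,e)$, $e^*\in\mathbb{E}^*$, $e\in\mathbb{E}$, with $\Lambda(e_a^*,\cdot)=\pi$, $\nu=\nu^*\Lambda$ and $\Lambda P=P^*\Lambda$. With $T^*$ the absorption time of $X^*$ in $e_a^*$, and separation distance $s(\nu P^n,\pi)=\max_{e\in\mathbb{E}}\left(1-\nu P^n(e)/\pi(e)\right)$, the SSD chain is called sharp if $s(\nu P^n,\pi)=P(T^*>n)$ for all $n\ge0$. In this statement the initial distribution of $X$ is $\nu=\delta_{(0,0)}$. The walk is reversible with stationary distribution $\pi((x,y))=C^{-1}\rho_1^x\rho_2^y$, with $C=\frac{1-\rho_1^{N+1}}{1-\rho_1}\cdot\frac{1-\rho_2^{N+1}}{1-\rho_2}$.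 *)

theory Defs
  imports "HOL-Probability.Probability"
begin

text \<open>
  Vectors and matrices over finite index sets are real functions together with an explicit
  carrier; only their values on the carrier matter.
\<close>

definition vec_kernel :: "'a set \<Rightarrow> ('a \<Rightarrow> real) \<Rightarrow> ('a \<Rightarrow> 'b \<Rightarrow> real) \<Rightarrow> 'b \<Rightarrow> real" where
  "vec_kernel S v K = (\<lambda>f. \<Sum>e\<in>S. v e * K e f)"

definition kernel_comp ::
  "'b set \<Rightarrow> ('a \<Rightarrow> 'b \<Rightarrow> real) \<Rightarrow> ('b \<Rightarrow> 'c \<Rightarrow> real) \<Rightarrow> 'a \<Rightarrow> 'c \<Rightarrow> real" where
  "kernel_comp S K L = (\<lambda>e f. \<Sum>g\<in>S. K e g * L g f)"

primrec kernel_pow :: "'a set \<Rightarrow> ('a \<Rightarrow> 'a \<Rightarrow> real) \<Rightarrow> nat \<Rightarrow> 'a \<Rightarrow> 'a \<Rightarrow> real" where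
  "kernel_pow S P 0 = (\<lambda>e f. of_bool (e = f))"
| "kernel_pow S P (Suc n) = kernel_comp S (kernel_pow S P n) P"

definition distribution_on :: "'a set \<Rightarrow> ('a \<Rightarrow> real) \<Rightarrow> bool" where
  "distribution_on S v \<longleftrightarrow> (\<forall>e\<in>S. 0 \<le> v e) \<and> (\<Sum>e\<in>S. v e) = 1"

definition stochastic_kernel :: "'a set \<Rightarrow> 'b set \<Rightarrow> ('a \<Rightarrow> 'b \<Rightarrow> real) \<Rightarrow> bool" where
  "stochastic_kernel S T K \<longleftrightarrow> (\<forall>e\<in>S. distribution_on T (K e))"

definition point_mass :: "'a \<Rightarrow> 'a \<Rightarrow> real" where
  "point_mass a = (\<lambda>e. of_bool (e = a))"

definition irreducible_kernel :: "'a set \<Rightarrow> ('a \<Rightarrow> 'a \<Rightarrow> real) \<Rightarrow> bool" where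
  "irreducible_kernel S P \<longleftrightarrow> (\<forall>e\<in>S. \<forall>f\<in>S. \<exists>n. 0 < kernel_pow S P n e f)"

definition aperiodic_kernel :: "'a set \<Rightarrow> ('a \<Rightarrow> 'a \<Rightarrow> real) \<Rightarrow> bool" where
  "aperiodic_kernel S P \<longleftrightarrow> (\<forall>e\<in>S. Gcd {n::nat. 0 < n \<and> 0 < kernel_pow S P n e e} = 1)"

definition ergodic_kernel :: "'a set \<Rightarrow> ('a \<Rightarrow> 'a \<Rightarrow> real) \<Rightarrow> bool" where
  "ergodic_kernel S P \<longleftrightarrow> irreducible_kernel S P \<and> aperiodic_kernel S P"

definition stationary_distribution ::
  "'a set \<Rightarrow> ('a \<Rightarrow> 'a \<Rightarrow> real) \<Rightarrow> ('a \<Rightarrow> real) \<Rightarrow> bool" where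
  "stationary_distribution S P p \<longleftrightarrow>
     distribution_on S p \<and> (\<forall>e\<in>S. vec_kernel S p P e = p e)"

text \<open>
  \<open>X\<close>, defined on the probability space \<open>M\<close>, is a time-homogeneous Markov chain with finite
  state space \<open>S\<close>, initial distribution \<open>v\<close> and transition matrix \<open>P\<close>.
\<close>

definition markov_chain ::
  "'w measure \<Rightarrow> (nat \<Rightarrow> 'w \<Rightarrow> 'a) \<Rightarrow> 'a set \<Rightarrow> ('a \<Rightarrow> real) \<Rightarrow> ('a \<Rightarrow> 'a \<Rightarrow> real) \<Rightarrow> bool" where
  "markov_chain M X S v P \<longleftrightarrow>
     prob_space M \<and> finite S \<and> distribution_on S v \<and> stochastic_kernel S S P \<and>
     (\<forall>n. X n \<in> measurable M (count_space S)) \<and>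
     (\<forall>e\<in>S. \<P>(w in M. X 0 w = e) = v e) \<and>
     (\<forall>n x. \<forall>e\<in>S. (\<forall>i\<le>n. x i \<in> S) \<longrightarrow> 0 < \<P>(w in M. \<forall>i\<le>n. X i w = x i) \<longrightarrow>
        \<P>(w in M. X (Suc n) w = e \<bar> \<forall>i\<le>n. X i w = x i) = P (x n) e)"

definition absorbing_state :: "('a \<Rightarrow> 'a \<Rightarrow> real) \<Rightarrow> 'a \<Rightarrow> bool" where
  "absorbing_state P a \<longleftrightarrow> P a a = 1"

definition absorbing_kernel :: "'a set \<Rightarrow> ('a \<Rightarrow> 'a \<Rightarrow> real) \<Rightarrow> bool" where
  "absorbing_kernel S P \<longleftrightarrow>
     (\<forall>e\<in>S. \<exists>a\<in>S. absorbing_state P a \<and> (\<exists>n. 0 < kernel_pow S P n e a))"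

text \<open>The value is \<open>\<infinity>\<close> if the chain never visits \<open>a\<close>.\<close>

definition absorption_time :: "(nat \<Rightarrow> 'w \<Rightarrow> 'a) \<Rightarrow> 'a \<Rightarrow> 'w \<Rightarrow> enat" where
  "absorption_time X a w = (INF n\<in>{n. X n w = a}. enat n)"

definition separation_distance :: "'a set \<Rightarrow> ('a \<Rightarrow> real) \<Rightarrow> ('a \<Rightarrow> real) \<Rightarrow> real" where
  "separation_distance S v p = Max ((\<lambda>e. 1 - v e / p e) ` S)"

text \<open>
  The chain \<open>Y\<close> on \<open>M'\<close>, with data \<open>S'\<close>, \<open>v'\<close>, \<open>P'\<close> and absorbing state \<open>a\<close>, is a strong
  stationary dual of the ergodic chain \<open>X\<close> on \<open>M\<close>, with data \<open>S\<close>, \<open>v\<close>, \<open>P\<close> and stationary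
  distribution \<open>p\<close>; the two chains need not live on the same probability space.
\<close>

definition strong_stationary_dual ::
  "'w measure \<Rightarrow> (nat \<Rightarrow> 'w \<Rightarrow> 'a) \<Rightarrow> 'a set \<Rightarrow> ('a \<Rightarrow> real) \<Rightarrow> ('a \<Rightarrow> 'a \<Rightarrow> real) \<Rightarrow> ('a \<Rightarrow> real) \<Rightarrow>
   'u measure \<Rightarrow> (nat \<Rightarrow> 'u \<Rightarrow> 'b) \<Rightarrow> 'b set \<Rightarrow> ('b \<Rightarrow> real) \<Rightarrow> ('b \<Rightarrow> 'b \<Rightarrow> real) \<Rightarrow> 'b \<Rightarrow> bool" where
  "strong_stationary_dual M X S v P p M' Y S' v' P' a \<longleftrightarrow>
     markov_chain M X S v P \<and> ergodic_kernel S P \<and> stationary_distribution S P p \<and>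
     markov_chain M' Y S' v' P' \<and> a \<in> S' \<and> absorbing_state P' a \<and>
     (\<exists>L. stochastic_kernel S' S L \<and>
          (\<forall>e\<in>S. L a e = p e) \<and>
          (\<forall>e\<in>S. v e = vec_kernel S' v' L e) \<and>
          (\<forall>e'\<in>S'. \<forall>e\<in>S. kernel_comp S L P e' e = kernel_comp S' P' L e' e))"

definition sharp_strong_stationary_dual ::
  "'w measure \<Rightarrow> (nat \<Rightarrow> 'w \<Rightarrow> 'a) \<Rightarrow> 'a set \<Rightarrow> ('a \<Rightarrow> real) \<Rightarrow> ('a \<Rightarrow> 'a \<Rightarrow> real) \<Rightarrow> ('a \<Rightarrow> real) \<Rightarrow>
   'u measure \<Rightarrow> (nat \<Rightarrow> 'u \<Rightarrow> 'b) \<Rightarrow> 'b set \<Rightarrow> ('b \<Rightarrow> real) \<Rightarrow> ('b \<Rightarrow> 'b \<Rightarrow> real) \<Rightarrow> 'b \<Rightarrow> bool" where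
  "sharp_strong_stationary_dual M X S v P p M' Y S' v' P' a \<longleftrightarrow>
     strong_stationary_dual M X S v P p M' Y S' v' P' a \<and>
     (\<forall>n. separation_distance S (vec_kernel S v (kernel_pow S P n)) p
            = \<P>(w in M'. enat n < absorption_time Y a w))"

definition lattice_square :: "nat \<Rightarrow> (nat \<times> nat) set" where
  "lattice_square N = {0..N} \<times> {0..N}"

definition lattice_walk ::
  "nat \<Rightarrow> real \<Rightarrow> real \<Rightarrow> real \<Rightarrow> real \<Rightarrow> nat \<times> nat \<Rightarrow> nat \<times> nat \<Rightarrow> real" where
  "lattice_walk N lam1 lam2 mu1 mu2 = (\<lambda>(x, y) (x', y').
     if x' = x + 1 \<and> y' = y then lam1
     else if x = x' + 1 \<and> y' = y then mu1
     else if x' = x \<and> y' = y + 1 then lam2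
     else if x' = x \<and> y = y' + 1 then mu2
     else if x' = x \<and> y' = y then
       1 - ((if x < N then lam1 else 0) + (if 0 < x then mu1 else 0)
          + (if y < N then lam2 else 0) + (if 0 < y then mu2 else 0))
     else 0)"

definition lattice_stationary :: "nat \<Rightarrow> real \<Rightarrow> real \<Rightarrow> nat \<times> nat \<Rightarrow> real" where
  "lattice_stationary N rho1 rho2 = (\<lambda>(x, y).
     rho1 ^ x * rho2 ^ y /
       ((1 - rho1 ^ (N + 1)) / (1 - rho1) * ((1 - rho2 ^ (N + 1)) / (1 - rho2))))"

text \<open>
  A step down is written \<open>x = x' + 1\<close>, since with truncated subtraction \<open>x' = x - 1\<close> would also
  hold for \<open>x = x' = 0\<close>. The conditions below are mutually exclusive on the lattice.
\<close>

definition lattice_dual ::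
  "nat \<Rightarrow> real \<Rightarrow> real \<Rightarrow> real \<Rightarrow> real \<Rightarrow> nat \<times> nat \<Rightarrow> nat \<times> nat \<Rightarrow> real" where
  "lattice_dual N lam1 lam2 mu1 mu2 =
     (let rho1 = lam1 / mu1; rho2 = lam2 / mu2 in (\<lambda>(x, y) (x', y').
     if x' = x + 1 \<and> y' = y then (1 - rho1 ^ (x + 2)) / (1 - rho1 ^ (x + 1)) * mu1
     else if y' = y + 1 \<and> x' = x then (1 - rho2 ^ (y + 2)) / (1 - rho2 ^ (y + 1)) * mu2
     else if x' = x \<and> y = y' + 1 \<and> y \<noteq> N then (1 - rho2 ^ y) / (1 - rho2 ^ (y + 1)) * lam2
     else if y' = y \<and> x = x' + 1 \<and> x \<noteq> N then (1 - rho1 ^ x) / (1 - rho1 ^ (x + 1)) * lam1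
     else if x' = x \<and> y' = y \<and> x < N \<and> y < N then 1 - (lam1 + lam2 + mu1 + mu2)
     else if x' = x \<and> y' = y \<and> y = N \<and> x < N then 1 - (lam1 + mu1)
     else if x' = x \<and> y' = y \<and> x = N \<and> y < N then 1 - (lam2 + mu2)
     else if x' = x \<and> y' = y \<and> x = N \<and> y = N then 1
     else 0))"

end

theory Submission
  imports Defs
begin

text \<open>
  The two coordinates of the walk move one at a time and do not influence each other, so its
  transition matrix is \<open>I + G\<^sub>1 \<otimes> I + I \<otimes> G\<^sub>2\<close> for two birth-death generators, and the proposed
  dual has the same form \<open>I + H\<^sub>1 \<otimes> I + I \<otimes> H\<^sub>2\<close>. If one-dimensional links satisfy
  \<open>L\<^sub>i G\<^sub>i = H\<^sub>i L\<^sub>i\<close>, then \<open>L\<^sub>1 \<otimes> L\<^sub>2\<close> intertwines the two lattice chains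
  (\<open>product_intertwining\<close>). The right link is the stationary law conditioned on an initial segment:
  row \<open>x\<close> of \<open>L\<^sub>i\<close> is the geometric law with ratio \<open>\<rho>\<^sub>i\<close> restricted to \<open>{0..x}\<close>. Reversibility turns
  row \<open>x\<close> of \<open>L\<^sub>i G\<^sub>i\<close> into \<open>G\<^sub>i\<close> acting on the indicator of \<open>{0..x}\<close>, which is concentrated on the
  two sites next to the edge of the segment, and a birth-death generator \<open>H\<^sub>i\<close> reproduces
  exactly this (\<open>birth_death_intertwining\<close>). In this computation the partial geometric sums
  \<open>1 + \<rho> + \<dots> + \<rho>\<^sup>n\<^sup>-\<^sup>1\<close> are used instead of \<open>(1 - \<rho>\<^sup>n) / (1 - \<rho>)\<close>, so that positivity is evident.

  At the absorbing corner \<open>(N, N)\<close> the link is the stationary law itself, and stationarity follows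
  from the intertwining because the corner is absorbing. Sharpness comes from the state \<open>(N, N)\<close>
  of the primal walk: only the row of the link at the absorbing corner charges it. Hence
  \<open>\<nu>P\<^sup>n(N, N) / \<pi>(N, N)\<close> is the probability that the dual is absorbed by time \<open>n\<close>, while at every
  other state the ratio is at least this large (\<open>sharp_dual_of_witness_state\<close>).

  The dual must also exist as a process. It is built from independent update instructions, one for
  each pair of a time and a state; the trajectory that follows these instructions has the required
  law on cylinders (\<open>canonical_markov_chain_exists\<close>).
\<close>

section \<open>Powers of kernels\<close>

lemma vec_kernel_vec_kernel:
  "vec_kernel T (vec_kernel S u K) L = vec_kernel S u (kernel_comp T K L)"
  unfolding vec_kernel_def kernel_comp_def sum_distrib_left sum_distrib_right
  by (subst sum.swap) (simp add: mult.assoc)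

lemma vec_kernel_pow_0:
  assumes "finite S" "e \<in> S"
  shows "vec_kernel S v (kernel_pow S P 0) e = v e"
  using assms by (simp add: vec_kernel_def of_bool_def if_distrib cong: if_cong)

lemma vec_kernel_pow_Suc:
  "vec_kernel S v (kernel_pow S P (Suc n)) = vec_kernel S (vec_kernel S v (kernel_pow S P n)) P"
  by (simp add: vec_kernel_vec_kernel)

lemma kernel_pow_nonneg:
  assumes "stochastic_kernel S S P" "f \<in> S" "e \<in> S"
  shows "0 \<le> kernel_pow S P n e f"
  using assms(2)
proof (induction n arbitrary: f)
  case (Suc n)
  then show ?case
    using assms by (auto simp: kernel_comp_def stochastic_kernel_def distribution_on_def intro!: sum_nonneg)
qed simp

lemma kernel_pow_Suc_pos:
  assumes P: "stochastic_kernel S S P" and S: "finite S" "e \<in> S" "g \<in> S" "f \<in> S"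
    and pos: "0 < kernel_pow S P n e g" "0 < P g f"
  shows "0 < kernel_pow S P (Suc n) e f"
proof -
  have "0 < kernel_pow S P n e g * P g f" using pos by simp
  also have "\<dots> \<le> (\<Sum>g\<in>S. kernel_pow S P n e g * P g f)"
    using S P kernel_pow_nonneg[OF P]
    by (intro member_le_sum) (auto simp: stochastic_kernel_def distribution_on_def)
  finally show ?thesis by (simp add: kernel_comp_def)
qed

lemma kernel_pow_add_pos:
  assumes P: "stochastic_kernel S S P" and S: "finite S" "e \<in> S" "g \<in> S" "f \<in> S"
    and pos: "0 < kernel_pow S P m e g" "0 < kernel_pow S P n g f"
  shows "0 < kernel_pow S P (m + n) e f"
  using S(4) pos(2)
proof (induction n arbitrary: f)
  case 0
  then show ?case using pos(1) by (auto simp: of_bool_def split: if_splits)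
next
  case (Suc n)
  have "0 < (\<Sum>h\<in>S. kernel_pow S P n g h * P h f)"
    using Suc.prems by (simp add: kernel_comp_def)
  then obtain h where h: "h \<in> S" "0 < kernel_pow S P n g h * P h f"
    by (meson not_le sum_nonpos)
  moreover have "0 \<le> kernel_pow S P n g h" using h P S kernel_pow_nonneg by metis
  ultimately have "0 < kernel_pow S P n g h" "0 < P h f"
    by (auto simp: zero_less_mult_iff)
  then show ?case
    using kernel_pow_Suc_pos[OF P S(1,2) h(1) Suc.prems(1)] Suc.IH h(1) by simp
qed

text \<open>
  Routes from \<open>e\<close> to \<open>g\<close> and back that use the loop once and twice give two consecutive return
  times for \<open>e\<close>.
\<close>
lemma aperiodic_of_loop:
  assumes P: "stochastic_kernel S S P" and S: "finite S" and irr: "irreducible_kernel S P"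
    and g: "g \<in> S" "0 < P g g"
  shows "aperiodic_kernel S P"
  unfolding aperiodic_kernel_def
proof
  fix e assume e: "e \<in> S"
  let ?R = "{n::nat. 0 < n \<and> 0 < kernel_pow S P n e e}"
  obtain m n where mn: "0 < kernel_pow S P m e g" "0 < kernel_pow S P n g e"
    using irr e g unfolding irreducible_kernel_def by blast
  have g1: "0 < kernel_pow S P (Suc m) e g"
    by (rule kernel_pow_Suc_pos[OF P S e g(1) g(1) mn(1) g(2)])
  have g2: "0 < kernel_pow S P (Suc (Suc m)) e g"
    by (rule kernel_pow_Suc_pos[OF P S e g(1) g(1) g1 g(2)])
  have "Suc m + n \<in> ?R" "Suc (Suc m) + n \<in> ?R"
    using kernel_pow_add_pos[OF P S e g(1) e g1 mn(2)] kernel_pow_add_pos[OF P S e g(1) e g2 mn(2)]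
    by auto
  then have "Gcd ?R dvd Suc m + n" "Gcd ?R dvd Suc (Suc m + n)"
    by (auto intro: Gcd_dvd)
  then have "Gcd ?R dvd Suc (Suc m + n) - (Suc m + n)" by (rule dvd_diff_nat[rotated])
  then show "Gcd ?R = 1" by simp
qed

lemma kernel_pow_reachable:
  assumes P: "stochastic_kernel S S P" and S: "finite S"
    and reach: "(\<lambda>e f. e \<in> S \<and> f \<in> S \<and> 0 < P e f)\<^sup>*\<^sup>* e f" and e: "e \<in> S"
  shows "\<exists>n. 0 < kernel_pow S P n e f"
  using reach
proof (induction rule: rtranclp_induct)
  case base
  have "0 < kernel_pow S P 0 e e" by simp
  then show ?case ..
next
  case (step f g)
  then show ?case using kernel_pow_Suc_pos[OF P S e] by blast
qed

section \<open>Existence of Markov chains\<close>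

text \<open>
  The coordinate \<open>(n, e)\<close> of \<open>w\<close> is read as the state to be entered at time \<open>n\<close> by a chain that sits
  at \<open>e\<close> at time \<open>n - 1\<close>. At time \<open>0\<close> there is no previous state, and \<open>undefined\<close> is an arbitrary
  fixed label.
\<close>
primrec trajectory :: "(nat \<times> 'a \<Rightarrow> 'a) \<Rightarrow> nat \<Rightarrow> 'a" where
  "trajectory w 0 = w (0, undefined)"
| "trajectory w (Suc n) = w (Suc n, trajectory w n)"

text \<open>
  Off the state space \<open>P e\<close> need not be a distribution; there \<open>v\<close> serves as a filler which makes
  every coordinate a probability space.
\<close>
definition instruction_law ::
  "'a set \<Rightarrow> ('a \<Rightarrow> real) \<Rightarrow> ('a \<Rightarrow> 'a \<Rightarrow> real) \<Rightarrow> nat \<times> 'a \<Rightarrow> 'a measure" where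
  "instruction_law S v P = (\<lambda>(n, e). point_measure S
     (\<lambda>f. ennreal (if n = 0 \<or> e \<notin> S then v f else P e f)))"

lemma point_measure_distribution:
  assumes "finite S" "distribution_on S v"
  shows "prob_space (point_measure S (\<lambda>f. ennreal (v f)))"
    and "f \<in> S \<Longrightarrow> emeasure (point_measure S (\<lambda>f. ennreal (v f))) {f} = ennreal (v f)"
proof -
  have "(\<Sum>f\<in>S. ennreal (v f)) = ennreal (\<Sum>f\<in>S. v f)"
    using assms by (intro sum_ennreal) (auto simp: distribution_on_def)
  then show "prob_space (point_measure S (\<lambda>f. ennreal (v f)))"
    using assms
    by (intro prob_spaceI) (simp add: space_point_measure emeasure_point_measure_finite distribution_on_def)
  show "f \<in> S \<Longrightarrow> emeasure (point_measure S (\<lambda>f. ennreal (v f))) {f} = ennreal (v f)"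
    using assms by (simp add: emeasure_point_measure_finite)
qed

lemma markov_chain_of_path_law:
  assumes "prob_space M" "finite S" "distribution_on S v" "stochastic_kernel S S P"
    and meas: "\<And>n. X n \<in> measurable M (count_space S)"
    and law: "\<And>n x. (\<forall>i\<le>n. x i \<in> S) \<Longrightarrow>
      \<P>(w in M. \<forall>i\<le>n. X i w = x i) = v (x 0) * (\<Prod>i<n. P (x i) (x (Suc i)))"
  shows "markov_chain M X S v P"
  unfolding markov_chain_def
proof (intro conjI allI ballI impI)
  fix e assume e: "e \<in> S"
  have "{w \<in> space M. X 0 w = e} = {w \<in> space M. \<forall>i\<le>0. X i w = (\<lambda>_. e) i}" by auto
  then show "\<P>(w in M. X 0 w = e) = v e" using law[of 0 "\<lambda>_. e"] e by simp
next
  fix n x e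
  assume e: "e \<in> S" and x: "\<forall>i\<le>n. x i \<in> S"
    and pos: "0 < \<P>(w in M. \<forall>i\<le>n. X i w = x i)"
  let ?y = "x(Suc n := e)"
  have "{w \<in> space M. X (Suc n) w = e \<and> (\<forall>i\<le>n. X i w = x i)}
      = {w \<in> space M. \<forall>i\<le>Suc n. X i w = ?y i}"
    by (auto simp: le_Suc_eq)
  moreover have "\<P>(w in M. \<forall>i\<le>Suc n. X i w = ?y i)
      = v (?y 0) * (\<Prod>i<Suc n. P (?y i) (?y (Suc i)))"
    using e x by (intro law) auto
  moreover have "(\<Prod>i<n. P (?y i) (?y (Suc i))) = (\<Prod>i<n. P (x i) (x (Suc i)))"
    by (intro prod.cong) auto
  ultimately have "\<P>(w in M. X (Suc n) w = e \<and> (\<forall>i\<le>n. X i w = x i))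
      = \<P>(w in M. \<forall>i\<le>n. X i w = x i) * P (x n) e"
    using law[OF x] by simp
  then show "\<P>(w in M. X (Suc n) w = e \<bar> \<forall>i\<le>n. X i w = x i) = P (x n) e"
    using pos by (simp add: cond_prob_def)
qed (use assms in auto)

lemma event_eq_measurable:
  assumes "X \<in> measurable M (count_space S)"
  shows "{w \<in> space M. X w = e} \<in> sets M"
proof -
  have "X -` ({e} \<inter> S) \<inter> space M \<in> sets M"
    using assms by (intro measurable_sets) auto
  moreover have "X -` ({e} \<inter> S) \<inter> space M = {w \<in> space M. X w = e}"
    using measurable_space[OF assms] by auto
  ultimately show ?thesis by simp
qed

text \<open>
  A path \<open>x\<^sub>0, \<dots>, x\<^sub>n\<close> reads the instructions at \<open>(0, undefined), (1, x\<^sub>0), \<dots>, (n, x\<^sub>n\<^sub>-\<^sub>1)\<close>. These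
  are distinct coordinates, since their times differ, and hence independent; so the path has
  probability \<open>v(x\<^sub>0) P(x\<^sub>0, x\<^sub>1) \<cdots> P(x\<^sub>n\<^sub>-\<^sub>1, x\<^sub>n)\<close>. Passing to the law of the whole trajectory gives a
  measure on sequences of states.
\<close>
lemma canonical_markov_chain_exists:
  fixes S :: "'a set"
  assumes S: "finite S" and v: "distribution_on S v" and P: "stochastic_kernel S S P"
  shows "\<exists>M :: (nat \<Rightarrow> 'a) measure. markov_chain M (\<lambda>n w. w n) S v P"
proof -
  let ?I = "instruction_law S v P"
  define Om where "Om = PiM UNIV ?I"
  define Q where "Q = PiM (UNIV :: nat set) (\<lambda>_. count_space S)"
  have dist: "distribution_on S (\<lambda>f. if n = 0 \<or> e \<notin> S then v f else P e f)" for n :: nat and e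
    using v P by (cases "n = 0 \<or> e \<notin> S") (auto simp: stochastic_kernel_def)
  have prob_I: "prob_space (?I j)" for j
    using point_measure_distribution(1)[OF S dist] by (cases j) (simp add: instruction_law_def)
  have sets_I: "sets (?I j) = Pow S" for j
    by (cases j) (simp add: instruction_law_def sets_point_measure)
  have emeas: "f \<in> S \<Longrightarrow> emeasure (?I (n, e)) {f} = ennreal (if n = 0 \<or> e \<notin> S then v f else P e f)"
    for f n e
    using point_measure_distribution(2)[OF S dist] by (simp add: instruction_law_def)
  interpret I: product_prob_space ?I UNIV
    by (rule product_prob_spaceI) (rule prob_I)
  interpret Om: prob_space Om unfolding Om_def by (rule I.P.prob_space_axioms)
  have comp: "(\<lambda>w. w j) \<in> measurable Om (count_space S)" for j
  proof -
    have "(\<lambda>w. w j) \<in> measurable Om (?I j)"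
      unfolding Om_def by measurable
    then show ?thesis
      using sets_I[of j] measurable_cong_sets[of Om Om "?I j" "count_space S"] by simp
  qed
  have trajectory: "(\<lambda>w. trajectory w n) \<in> measurable Om (count_space S)" for n
  proof (induction n)
    case 0
    then show ?case using comp by simp
  next
    case (Suc n)
    then show ?case
      using measurable_compose_countable'[OF comp Suc countable_finite[OF S], of "\<lambda>i. (Suc n, i)"]
      by simp
  qed
  have trajQ: "trajectory \<in> measurable Om Q"
    unfolding Q_def
    by (intro measurable_PiM_single') (use trajectory measurable_space[OF trajectory] in auto)
  have law: "\<P>(w in Om. \<forall>i\<le>n. trajectory w i = x i) = v (x 0) * (\<Prod>i<n. P (x i) (x (Suc i)))"
    if x: "\<forall>i\<le>n. x i \<in> S" for n x
  proof -
    define a where "a i = (i, case i of 0 \<Rightarrow> undefined | Suc k \<Rightarrow> x k)" for i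
    have inj: "inj_on a {..n}" by (auto simp: inj_on_def a_def)
    have nn: "0 \<le> v f" "\<And>e. e \<in> S \<Longrightarrow> 0 \<le> P e f" if "f \<in> S" for f
      using v P that by (auto simp: stochastic_kernel_def distribution_on_def)
    have "(\<forall>i\<le>n. trajectory w i = x i) \<longleftrightarrow> (\<forall>i\<le>n. w (a i) = x i)" for w
    proof (induction n)
      case (Suc n)
      then show ?case by (auto simp: le_Suc_eq a_def)
    qed (simp add: a_def)
    then have "{w \<in> space Om. \<forall>i\<le>n. trajectory w i = x i}
      = {w \<in> space Om. \<forall>j\<in>a ` {..n}. w j \<in> {x (fst j)}}"
      by (auto simp: a_def)
    also have "emeasure Om \<dots> = (\<Prod>j\<in>a ` {..n}. emeasure (?I j) {x (fst j)})"
      unfolding Om_def by (rule I.emeasure_PiM_Collect) (use x in \<open>auto simp: sets_I a_def\<close>)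
    also have "\<dots> = (\<Prod>i\<le>n. emeasure (?I (a i)) {x i})"
      by (subst prod.reindex[OF inj]) (simp add: a_def)
    also have "\<dots> = emeasure (?I (a 0)) {x 0} * (\<Prod>i<n. emeasure (?I (a (Suc i))) {x (Suc i)})"
      by (simp add: lessThan_Suc_atMost[symmetric] prod.lessThan_Suc_shift del: prod.lessThan_Suc)
    also have "\<dots> = ennreal (v (x 0)) * (\<Prod>i<n. ennreal (P (x i) (x (Suc i))))"
      using x by (intro arg_cong2[where f="(*)"] prod.cong) (auto simp: a_def emeas)
    also have "\<dots> = ennreal (v (x 0) * (\<Prod>i<n. P (x i) (x (Suc i))))"
      using x nn by (subst prod_ennreal) (auto intro!: ennreal_mult[symmetric] prod_nonneg)
    finally have eq: "emeasure Om {w \<in> space Om. \<forall>i\<le>n. trajectory w i = x i}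
      = ennreal (v (x 0) * (\<Prod>i<n. P (x i) (x (Suc i))))" .
    have "0 \<le> v (x 0) * (\<Prod>i<n. P (x i) (x (Suc i)))"
      using x nn by (intro mult_nonneg_nonneg prod_nonneg) auto
    with eq show ?thesis by (simp add: Om.emeasure_eq_measure)
  qed
  let ?M = "distr Om Q trajectory"
  have proj: "(\<lambda>w. w n) \<in> measurable Q (count_space S)" for n
    unfolding Q_def by measurable
  have "markov_chain ?M (\<lambda>n w. w n) S v P"
  proof (rule markov_chain_of_path_law[OF _ S v P])
    show "prob_space ?M" using trajQ by (rule Om.prob_space_distr)
    show "(\<lambda>w. w n) \<in> measurable ?M (count_space S)" for n using proj by simp
    fix n and x :: "nat \<Rightarrow> 'a" assume x: "\<forall>i\<le>n. x i \<in> S"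
    have single: "{w \<in> space Q. w i = x i} \<in> sets Q" for i
      using event_eq_measurable[OF proj] .
    have cylinder: "{w \<in> space Q. \<forall>i\<le>n. w i = x i} = (\<Inter>i\<in>{..n}. {w \<in> space Q. w i = x i})"
      by auto
    have "{w \<in> space Q. \<forall>i\<le>n. w i = x i} \<in> sets Q" (is "?C \<in> _")
      unfolding cylinder by (intro sets.finite_INT single) simp_all
    then have "measure ?M ?C = measure Om (trajectory -` ?C \<inter> space Om)"
      by (rule measure_distr[OF trajQ])
    also have "trajectory -` ?C \<inter> space Om = {w \<in> space Om. \<forall>i\<le>n. trajectory w i = x i}"
      using measurable_space[OF trajQ] by blast
    finally show "\<P>(w in ?M. \<forall>i\<le>n. w i = x i) = v (x 0) * (\<Prod>i<n. P (x i) (x (Suc i)))"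
      using law[OF x] by simp
  qed
  then show ?thesis by blast
qed

section \<open>Marginals and absorption times\<close>

text \<open>
  The Markov property conditions on complete histories, so both sides are summed over the finitely
  many histories that end in \<open>e\<close> at time \<open>n\<close>.
\<close>
lemma markov_chain_one_step:
  assumes mc: "markov_chain M X S v P" and e: "e \<in> S" and f: "f \<in> S"
  shows "\<P>(w in M. X n w = e \<and> X (Suc n) w = f) = \<P>(w in M. X n w = e) * P e f"
proof -
  interpret prob_space M using mc by (simp add: markov_chain_def)
  have S: "finite S" and meas: "\<And>n. X n \<in> measurable M (count_space S)"
    and cond: "\<And>n x e. \<lbrakk>e \<in> S; \<forall>i\<le>n. x i \<in> S; 0 < \<P>(w in M. \<forall>i\<le>n. X i w = x i)\<rbrakk> \<Longrightarrow>
        \<P>(w in M. X (Suc n) w = e \<bar> \<forall>i\<le>n. X i w = x i) = P (x n) e"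
    using mc by (auto simp: markov_chain_def)
  note ev [measurable] = event_eq_measurable[OF meas]
  define H where "H = {x \<in> PiE {..n} (\<lambda>_. S). x n = e}"
  have H: "finite H" unfolding H_def
    by (rule finite_subset[of _ "PiE {..n} (\<lambda>_. S)"]) (use S in \<open>auto intro: finite_PiE\<close>)
  have part: "\<P>(w in M. X n w = e \<and> Q w) = (\<Sum>x\<in>H. \<P>(w in M. (\<forall>i\<le>n. X i w = x i) \<and> Q w))"
    if Q [measurable]: "{w \<in> space M. Q w} \<in> sets M" for Q
  proof -
    have "{w \<in> space M. X n w = e \<and> Q w}
        = (\<Union>x\<in>H. {w \<in> space M. (\<forall>i\<le>n. X i w = x i) \<and> Q w})" (is "?A = ?B")
    proof
      show "?A \<subseteq> ?B"
      proof
        fix w assume w: "w \<in> ?A"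
        have "restrict (\<lambda>i. X i w) {..n} \<in> H"
          using w measurable_space[OF meas] by (auto simp: H_def)
        with w show "w \<in> ?B" by (intro UN_I[of "restrict (\<lambda>i. X i w) {..n}"]) auto
      qed
      show "?B \<subseteq> ?A" by (auto simp: H_def)
    qed
    moreover have "disjoint_family_on (\<lambda>x. {w \<in> space M. (\<forall>i\<le>n. X i w = x i) \<and> Q w}) H"
      unfolding disjoint_family_on_def
    proof (intro ballI impI)
      fix x y assume xy: "x \<in> H" "y \<in> H" "x \<noteq> y"
      then have "\<exists>i\<le>n. x i \<noteq> y i"
        by (auto simp: H_def dest: PiE_ext)
      then show "{w \<in> space M. (\<forall>i\<le>n. X i w = x i) \<and> Q w}
          \<inter> {w \<in> space M. (\<forall>i\<le>n. X i w = y i) \<and> Q w} = {}" by fastforce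
    qed
    moreover have "(\<lambda>x. {w \<in> space M. (\<forall>i\<le>n. X i w = x i) \<and> Q w}) ` H \<subseteq> sets M"
      by (intro image_subsetI) measurable
    ultimately show ?thesis
      using finite_measure_finite_Union[OF H] by simp
  qed
  have step: "\<P>(w in M. (\<forall>i\<le>n. X i w = x i) \<and> X (Suc n) w = f)
      = \<P>(w in M. \<forall>i\<le>n. X i w = x i) * P e f" if x: "x \<in> H" for x
  proof (cases "\<P>(w in M. \<forall>i\<le>n. X i w = x i) = 0")
    case True
    have "\<P>(w in M. (\<forall>i\<le>n. X i w = x i) \<and> X (Suc n) w = f) \<le> \<P>(w in M. \<forall>i\<le>n. X i w = x i)"
      by (intro finite_measure_mono) auto
    with True show ?thesis by (simp add: measure_le_0_iff)
  next
    case False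
    then have pos: "0 < \<P>(w in M. \<forall>i\<le>n. X i w = x i)" by (simp add: zero_less_measure_iff)
    have "\<P>(w in M. X (Suc n) w = f \<bar> \<forall>i\<le>n. X i w = x i) = P (x n) f"
      using x f pos by (intro cond) (auto simp: H_def)
    with pos x show ?thesis by (simp add: cond_prob_def field_simps H_def conj_commute)
  qed
  have "\<P>(w in M. X n w = e \<and> X (Suc n) w = f)
      = (\<Sum>x\<in>H. \<P>(w in M. \<forall>i\<le>n. X i w = x i)) * P e f"
    by (simp add: part step sum_distrib_right)
  also have "(\<Sum>x\<in>H. \<P>(w in M. \<forall>i\<le>n. X i w = x i)) = \<P>(w in M. X n w = e)"
    using part[of "\<lambda>_. True"] by simp
  finally show ?thesis .
qed

lemma markov_chain_marginal:
  assumes mc: "markov_chain M X S v P" and f: "f \<in> S"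
  shows "\<P>(w in M. X n w = f) = vec_kernel S v (kernel_pow S P n) f"
  using f
proof (induction n arbitrary: f)
  case 0
  have "finite S" "\<P>(w in M. X 0 w = f) = v f"
    using mc 0 by (auto simp: markov_chain_def)
  then show ?case using 0 vec_kernel_pow_0 by metis
next
  case (Suc n)
  interpret prob_space M using mc by (simp add: markov_chain_def)
  have S: "finite S" and meas: "\<And>n. X n \<in> measurable M (count_space S)"
    using mc by (auto simp: markov_chain_def)
  note ev [measurable] = event_eq_measurable[OF meas]
  have "{w \<in> space M. X (Suc n) w = f} = (\<Union>e\<in>S. {w \<in> space M. X n w = e \<and> X (Suc n) w = f})"
    using measurable_space[OF meas] by auto
  then have "\<P>(w in M. X (Suc n) w = f) = (\<Sum>e\<in>S. \<P>(w in M. X n w = e \<and> X (Suc n) w = f))"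
    using S by (simp, subst finite_measure_finite_Union) (auto simp: disjoint_family_on_def)
  also have "\<dots> = (\<Sum>e\<in>S. vec_kernel S v (kernel_pow S P n) e * P e f)"
    using Suc by (simp add: markov_chain_one_step[OF mc])
  also have "\<dots> = vec_kernel S v (kernel_pow S P (Suc n)) f"
    by (simp add: vec_kernel_pow_Suc vec_kernel_def[of S _ P] del: kernel_pow.simps)
  finally show ?case .
qed

lemma absorbing_row:
  assumes S: "finite S" and P: "stochastic_kernel S S P" and a: "a \<in> S" "absorbing_state P a"
    and f: "f \<in> S" "f \<noteq> a"
  shows "P a f = 0"
proof -
  have "(\<Sum>g\<in>S - {a}. P a g) = 0"
    using a P S by (simp add: stochastic_kernel_def distribution_on_def absorbing_state_def sum_diff1)
  then show ?thesis
    using f P a S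
    by (subst (asm) sum_nonneg_eq_0_iff) (auto simp: stochastic_kernel_def distribution_on_def)
qed

text \<open>
  Almost surely the chain never leaves \<open>a\<close>, so being at \<open>a\<close> at time \<open>n\<close> and having visited \<open>a\<close> by
  time \<open>n\<close> are the same event up to a null set.
\<close>
lemma absorption_time_tail:
  assumes mc: "markov_chain M X S v P" and a: "a \<in> S" "absorbing_state P a"
  shows "\<P>(w in M. enat n < absorption_time X a w) = 1 - \<P>(w in M. X n w = a)"
proof -
  interpret prob_space M using mc by (simp add: markov_chain_def)
  have S: "finite S" and meas: "\<And>n. X n \<in> measurable M (count_space S)"
    and P: "stochastic_kernel S S P"
    using mc by (auto simp: markov_chain_def)
  note ev [measurable] = event_eq_measurable[OF meas]
  note leave = absorbing_row[OF S P a]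
  have "AE w in M. \<forall>n. \<forall>f\<in>S - {a}. \<not> (X n w = a \<and> X (Suc n) w = f)"
  proof (intro AE_all_countable[THEN iffD2] allI AE_finite_allI)
    fix n f assume f: "f \<in> S - {a}"
    then have "\<P>(w in M. X n w = a \<and> X (Suc n) w = f) = 0"
      using markov_chain_one_step[OF mc] a leave by simp
    then show "AE w in M. \<not> (X n w = a \<and> X (Suc n) w = f)"
      by (subst AE_iff_measurable[OF _ refl]) (auto simp: emeasure_eq_measure)
  qed (use S in auto)
  then have stay: "AE w in M. \<forall>n. X n w = a \<longrightarrow> X (Suc n) w = a"
    using AE_space
  proof eventually_elim
    case (elim w)
    have "X (Suc n) w \<in> S" for n
      using measurable_space[OF meas elim(2), of "Suc n"] by simp
    with elim(1) show ?case by auto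
  qed
  have tail: "enat n < absorption_time X a w \<longleftrightarrow> (\<forall>i\<le>n. X i w \<noteq> a)" for w
  proof -
    have "absorption_time X a w \<le> enat n \<longleftrightarrow> (\<exists>i\<le>n. X i w = a)"
    proof
      assume le: "absorption_time X a w \<le> enat n"
      have "{n. X n w = a} \<noteq> {}"
      proof
        assume "{n. X n w = a} = {}"
        with le show False unfolding absorption_time_def by (simp add: top_enat_def)
      qed
      then have "absorption_time X a w \<in> enat ` {n. X n w = a}"
        unfolding absorption_time_def
        by (metis (no_types, lifting) Inf_enat_def LeastI_ex image_is_empty ex_in_conv)
      with le show "\<exists>i\<le>n. X i w = a" by auto
    next
      assume "\<exists>i\<le>n. X i w = a"
      then obtain i where "i \<le> n" "X i w = a" by auto
      then show "absorption_time X a w \<le> enat n"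
        unfolding absorption_time_def by (intro INF_lower2[of i]) auto
    qed
    then show ?thesis by (auto simp: not_le[symmetric])
  qed
  have "\<P>(w in M. \<forall>i\<le>n. X i w \<noteq> a) = \<P>(w in M. \<not> X n w = a)"
  proof (rule finite_measure_eq_AE)
    show "AE w in M. w \<in> {w \<in> space M. \<forall>i\<le>n. X i w \<noteq> a} \<longleftrightarrow> w \<in> {w \<in> space M. \<not> X n w = a}"
      using stay
    proof eventually_elim
      case (elim w)
      have "X i w = a \<Longrightarrow> i \<le> n \<Longrightarrow> X n w = a" for i
        by (rule dec_induct[of i n "\<lambda>k. X k w = a"]) (use elim in auto)
      then show ?case by auto
    qed
  qed measurable
  also have "\<dots> = 1 - \<P>(w in M. X n w = a)"
    by (rule prob_neg) measurable
  finally show ?thesis by (simp add: tail)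
qed

section \<open>Intertwining and sharpness\<close>

lemma intertwining_pow:
  assumes S: "finite S" "finite S'"
    and init: "\<forall>e\<in>S. v e = vec_kernel S' v' L e"
    and int: "\<forall>e'\<in>S'. \<forall>e\<in>S. kernel_comp S L P e' e = kernel_comp S' P' L e' e"
    and e: "e \<in> S"
  shows "vec_kernel S v (kernel_pow S P n) e
       = vec_kernel S' (vec_kernel S' v' (kernel_pow S' P' n)) L e"
  using e
proof (induction n arbitrary: e)
  case 0
  then show ?case
    using init by (simp add: vec_kernel_pow_0 S vec_kernel_def[of S' _ L] del: kernel_pow.simps)
next
  case (Suc n)
  let ?u = "vec_kernel S' v' (kernel_pow S' P' n)"
  have "vec_kernel S v (kernel_pow S P (Suc n)) e = vec_kernel S (vec_kernel S' ?u L) P e"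
    unfolding vec_kernel_pow_Suc using Suc.IH by (simp add: vec_kernel_def[of S _ P])
  also have "\<dots> = vec_kernel S' ?u (kernel_comp S' P' L) e"
    unfolding vec_kernel_vec_kernel[where u = ?u]
    using int Suc.prems by (simp add: vec_kernel_def[of S' ?u])
  finally show ?case
    unfolding vec_kernel_pow_Suc vec_kernel_vec_kernel[where u = ?u] .
qed

text \<open>
  The intertwining at the absorbing state reads \<open>p P = L(a, \<cdot>) P = P'(a, \<cdot>) L = L(a, \<cdot>) = p\<close>.
\<close>
lemma stationary_of_absorbing_link:
  assumes S': "finite S'" and P': "stochastic_kernel S' S' P'" and a: "a \<in> S'" "absorbing_state P' a"
    and L: "stochastic_kernel S' S L" and top: "\<forall>e\<in>S. L a e = p e"
    and int: "\<forall>e'\<in>S'. \<forall>e\<in>S. kernel_comp S L P e' e = kernel_comp S' P' L e' e"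
  shows "stationary_distribution S P p"
  unfolding stationary_distribution_def
proof (intro conjI ballI)
  have "distribution_on S (L a)" using L a by (simp add: stochastic_kernel_def)
  then show "distribution_on S p" using top by (simp add: distribution_on_def)
  fix e assume e: "e \<in> S"
  have "vec_kernel S p P e = kernel_comp S L P a e"
    using top by (simp add: vec_kernel_def kernel_comp_def)
  also have "\<dots> = (\<Sum>g\<in>S'. P' a g * L g e)"
    using int a e by (simp add: kernel_comp_def)
  also have "\<dots> = (\<Sum>g\<in>S'. if g = a then L a e else 0)"
    using absorbing_row[OF S' P' a] a by (intro sum.cong) (auto simp: absorbing_state_def)
  also have "\<dots> = p e" using S' a top e by simp
  finally show "vec_kernel S p P e = p e" .
qed

text \<open>
  With \<open>u = v' P'\<^sup>n\<close> the law of the dual at time \<open>n\<close>, the law of the primal chain is \<open>u L\<close>, and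
  \<open>(u L)(e) \<ge> u(a) L(a, e) = u(a) p(e)\<close> for every \<open>e\<close>. Equality holds at a state \<open>e0\<close> charged only by
  the row of \<open>L\<close> at \<open>a\<close>. So the maximum in the separation distance is \<open>1 - u(a)\<close>, attained at \<open>e0\<close>.
\<close>
theorem sharp_dual_of_witness_state:
  assumes X: "markov_chain M X S v P" and erg: "ergodic_kernel S P"
    and Y: "markov_chain M' Y S' v' P'" and a: "a \<in> S'" "absorbing_state P' a"
    and L: "stochastic_kernel S' S L" and top: "\<forall>e\<in>S. L a e = p e"
    and init: "\<forall>e\<in>S. v e = vec_kernel S' v' L e"
    and int: "\<forall>e'\<in>S'. \<forall>e\<in>S. kernel_comp S L P e' e = kernel_comp S' P' L e' e"
    and pos: "\<forall>e\<in>S. 0 < p e"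
    and witness: "e0 \<in> S" "\<forall>e'\<in>S' - {a}. L e' e0 = 0"
  shows "sharp_strong_stationary_dual M X S v P p M' Y S' v' P' a"
  unfolding sharp_strong_stationary_dual_def
proof (intro conjI allI)
  have S: "finite S" and S': "finite S'" and P': "stochastic_kernel S' S' P'"
    using X Y by (auto simp: markov_chain_def)
  show "strong_stationary_dual M X S v P p M' Y S' v' P' a"
    unfolding strong_stationary_dual_def
    using X erg Y a L top init int stationary_of_absorbing_link[OF S' P' a L top int] by blast
  fix n
  define u where "u = vec_kernel S' v' (kernel_pow S' P' n)"
  have u: "u e' = \<P>(w in M'. Y n w = e')" if "e' \<in> S'" for e'
    using markov_chain_marginal[OF Y that] by (simp add: u_def)
  have law: "vec_kernel S v (kernel_pow S P n) e = u a * p e + (\<Sum>e'\<in>S' - {a}. u e' * L e' e)"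
    if "e \<in> S" for e
    using intertwining_pow[OF S S' init int that, of n] that top S' a
    by (simp add: u_def[symmetric] vec_kernel_def[of S' u] sum.remove)
  have ge: "u a \<le> vec_kernel S v (kernel_pow S P n) e / p e" if e: "e \<in> S" for e
  proof -
    have "0 \<le> (\<Sum>e'\<in>S' - {a}. u e' * L e' e)"
      using u L e by (intro sum_nonneg) (auto simp: stochastic_kernel_def distribution_on_def)
    then show ?thesis using law[OF e] pos e by (simp add: pos_le_divide_eq)
  qed
  have eq: "u a = vec_kernel S v (kernel_pow S P n) e0 / p e0"
    using law[OF witness(1)] witness pos[rule_format, OF witness(1)] by simp
  have "separation_distance S (vec_kernel S v (kernel_pow S P n)) p = 1 - u a"
    unfolding separation_distance_def
  proof (rule Max_eqI)
    show "1 - u a \<in> (\<lambda>e. 1 - vec_kernel S v (kernel_pow S P n) e / p e) ` S"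
      using eq witness(1) by auto
  qed (use S ge in auto)
  also have "\<dots> = \<P>(w in M'. enat n < absorption_time Y a w)"
    using absorption_time_tail[OF Y a] u[OF a(1)] by simp
  finally show "separation_distance S (vec_kernel S v (kernel_pow S P n)) p
      = \<P>(w in M'. enat n < absorption_time Y a w)" .
qed

section \<open>Duality for a one-dimensional birth-death chain\<close>

definition geom_sum :: "real \<Rightarrow> nat \<Rightarrow> real" where
  "geom_sum r n = (\<Sum>i<n. r ^ i)"

lemma geom_sum_simps:
  "geom_sum r 0 = 0" "geom_sum r (Suc n) = geom_sum r n + r ^ n"
  by (simp_all add: geom_sum_def)

lemma geom_sum_shift: "geom_sum r (Suc n) = 1 + r * geom_sum r n"
proof (induction n)
  case (Suc n)
  then have "geom_sum r (Suc (Suc n)) = 1 + r * geom_sum r n + r ^ Suc n"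
    using geom_sum_simps(2)[of r "Suc n"] by simp
  also have "\<dots> = 1 + r * geom_sum r (Suc n)"
    by (simp add: geom_sum_simps algebra_simps)
  finally show ?case .
qed (simp add: geom_sum_simps)

lemma geom_sum_pos: "0 < r \<Longrightarrow> 0 < n \<Longrightarrow> 0 < geom_sum r n"
  unfolding geom_sum_def by (intro sum_pos) auto

lemma geom_sum_eq: "r \<noteq> 1 \<Longrightarrow> (1 - r ^ n) / (1 - r) = geom_sum r n"
  unfolding geom_sum_def by (simp add: sum_gp_strict)

text \<open>
  The diagonal is chosen so that the rows sum to \<open>0\<close> over \<open>{0..N}\<close> as soon as no rate leads out of
  this interval, that is, \<open>u N = 0\<close> and \<open>d 0 = 0\<close>.
\<close>
definition birth_death_generator :: "(nat \<Rightarrow> real) \<Rightarrow> (nat \<Rightarrow> real) \<Rightarrow> nat \<Rightarrow> nat \<Rightarrow> real" where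
  "birth_death_generator u d x z =
     (if z = x + 1 then u x else if x = z + 1 then d x else if z = x then - (u x + d x) else 0)"

lemma birth_death_generator_apply:
  assumes x: "x \<le> N" and u: "u N = 0" and d: "d 0 = 0"
  shows "(\<Sum>z\<in>{0..N}. birth_death_generator u d x z * h z)
    = u x * (h (x + 1) - h x) + d x * (h (x - 1) - h x)"
proof -
  \<comment> \<open>For \<open>x = 0\<close> the truncated \<open>x - 1\<close> is \<open>0\<close>, which is harmless because \<open>d 0 = 0\<close>.\<close>
  have "birth_death_generator u d x z * h z = (if z = x + 1 then u x * h (x + 1) else 0)
      + (if z = x - 1 then d x * h (x - 1) else 0) + (if z = x then - (u x + d x) * h x else 0)" for z
    using d by (auto simp: birth_death_generator_def)
  then have "(\<Sum>z\<in>{0..N}. birth_death_generator u d x z * h z)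
    = (if x + 1 \<le> N then u x * h (x + 1) else 0) + d x * h (x - 1) - (u x + d x) * h x"
    using x by (simp add: sum.distrib algebra_simps)
  also have "(if x + 1 \<le> N then u x * h (x + 1) else 0) = u x * h (x + 1)"
    using x u by (cases "x = N") auto
  finally show ?thesis by (simp add: algebra_simps)
qed

definition bd_up :: "nat \<Rightarrow> real \<Rightarrow> nat \<Rightarrow> real" where
  "bd_up N lam x = (if x < N then lam else 0)"
definition bd_down :: "real \<Rightarrow> nat \<Rightarrow> real" where
  "bd_down mu x = (if 0 < x then mu else 0)"
definition dual_up :: "nat \<Rightarrow> real \<Rightarrow> real \<Rightarrow> nat \<Rightarrow> real" where
  "dual_up N r mu x = (if x < N then geom_sum r (x + 2) / geom_sum r (x + 1) * mu else 0)"
definition dual_down :: "nat \<Rightarrow> real \<Rightarrow> real \<Rightarrow> nat \<Rightarrow> real" where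
  "dual_down N r lam x = (if x < N then geom_sum r x / geom_sum r (x + 1) * lam else 0)"
definition truncated_geometric :: "real \<Rightarrow> nat \<Rightarrow> nat \<Rightarrow> real" where
  "truncated_geometric r x z = (if z \<le> x then r ^ z / geom_sum r (x + 1) else 0)"

text \<open>
  In the interior the dual has the same total jump rate as the primal chain, which is why the two
  chains have the same holding probabilities there.
\<close>
lemma dual_rates_sum:
  assumes "0 < r" "lam = r * mu" "x < N"
  shows "dual_up N r mu x + dual_down N r lam x = lam + mu"
proof -
  have "0 < geom_sum r (x + 1)" using assms by (intro geom_sum_pos) auto
  moreover have "geom_sum r (x + 2) * mu + geom_sum r x * lam = (lam + mu) * geom_sum r (x + 1)"
    using geom_sum_shift[of r "x + 1"] geom_sum_shift[of r x] assms(2) by (simp add: algebra_simps)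
  ultimately show ?thesis
    using assms(3) by (simp add: dual_up_def dual_down_def field_simps)
qed

text \<open>
  By detailed balance \<open>\<rho>\<^sup>w G(w, z) = \<rho>\<^sup>z G(z, w)\<close>, the left-hand side is \<open>\<rho>\<^sup>z / Z(x)\<close> times \<open>G\<close> applied
  to the indicator of \<open>{0..x}\<close> at \<open>z\<close>, where \<open>Z(x) = 1 + \<dots> + \<rho>\<^sup>x\<close>. For \<open>x < N\<close> this indicator
  expression is \<open>\<mu> 1[z \<le> x+1] + \<lambda> 1[z < x] - (\<lambda> + \<mu>) 1[z \<le> x]\<close>, a combination of the indicators of
  the supports of rows \<open>x + 1\<close>, \<open>x - 1\<close> and \<open>x\<close> of the link; renormalising these rows gives the dual rates
  \<open>\<mu> Z(x+1) / Z(x)\<close> and \<open>\<lambda> Z(x-1) / Z(x)\<close>. For \<open>x = N\<close> the indicator is constant and both sides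
  vanish.
\<close>
lemma birth_death_intertwining:
  assumes r: "0 < r" and lam: "lam = r * mu" and x: "x \<le> N" and z: "z \<le> N"
  shows "kernel_comp {0..N} (truncated_geometric r)
           (birth_death_generator (bd_up N lam) (bd_down mu)) x z
       = kernel_comp {0..N}
           (birth_death_generator (dual_up N r mu) (dual_down N r lam)) (truncated_geometric r) x z"
proof -
  let ?G = "birth_death_generator (bd_up N lam) (bd_down mu)"
  let ?Z = "geom_sum r (x + 1)"
  let ?h = "\<lambda>w. of_bool (w \<le> x) :: real"
  have Z: "0 < geom_sum r (Suc n)" for n using r by (intro geom_sum_pos) auto
  have reversible: "r ^ w * ?G w z = r ^ z * ?G z w" if "w \<le> N" for w
    using that z lam by (auto simp: birth_death_generator_def bd_up_def bd_down_def)
  have "kernel_comp {0..N} (truncated_geometric r) ?G x z = (\<Sum>w\<in>{0..N}. r ^ z / ?Z * (?G z w * ?h w))"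
    unfolding kernel_comp_def
  proof (rule sum.cong[OF refl])
    fix w assume "w \<in> {0..N}"
    then show "truncated_geometric r x w * ?G w z = r ^ z / ?Z * (?G z w * ?h w)"
      using reversible[of w] by (simp add: truncated_geometric_def)
  qed
  also have "\<dots> = r ^ z / ?Z * (bd_up N lam z * (?h (z + 1) - ?h z) + bd_down mu z * (?h (z - 1) - ?h z))"
    unfolding sum_distrib_left[symmetric]
    by (subst birth_death_generator_apply[OF z]) (auto simp: bd_up_def bd_down_def)
  also have "\<dots> = dual_up N r mu x * (truncated_geometric r (x + 1) z - truncated_geometric r x z)
      + dual_down N r lam x * (truncated_geometric r (x - 1) z - truncated_geometric r x z)"
  proof (cases "x < N")
    case False
    then show ?thesis using x z
      by (auto simp: dual_up_def dual_down_def bd_up_def)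
  next
    case True
    let ?t = "r ^ z / ?Z"
    have up: "dual_up N r mu x * truncated_geometric r (x + 1) z = mu * ?t * of_bool (z \<le> x + 1)"
      using True Z[of "Suc x"] by (simp add: dual_up_def truncated_geometric_def)
    have down: "dual_down N r lam x * truncated_geometric r (x - 1) z = lam * ?t * of_bool (z < x)"
      using True Z[of "x - 1"]
      by (cases x) (auto simp: dual_down_def truncated_geometric_def geom_sum_simps(1))
    have stay: "(dual_up N r mu x + dual_down N r lam x) * truncated_geometric r x z = (lam + mu) * ?t * ?h z"
      unfolding dual_rates_sum[OF r lam True] by (simp add: truncated_geometric_def)
    have rate: "bd_up N lam z * (?h (z + 1) - ?h z) + bd_down mu z * (?h (z - 1) - ?h z)
      = mu * of_bool (z \<le> x + 1) + lam * of_bool (z < x) - (lam + mu) * ?h z"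
      using True by (auto simp: bd_up_def bd_down_def of_bool_def)
    have "?t * (bd_up N lam z * (?h (z + 1) - ?h z) + bd_down mu z * (?h (z - 1) - ?h z))
      = mu * ?t * of_bool (z \<le> x + 1) + lam * ?t * of_bool (z < x) - (lam + mu) * ?t * ?h z"
      unfolding rate by (simp only: algebra_simps)
    with up down stay show ?thesis by (simp add: algebra_simps)
  qed
  also have "\<dots> = kernel_comp {0..N} (birth_death_generator (dual_up N r mu) (dual_down N r lam))
      (truncated_geometric r) x z"
    unfolding kernel_comp_def
    by (subst birth_death_generator_apply[OF x]) (auto simp: dual_up_def dual_down_def geom_sum_simps(1))
  finally show ?thesis .
qed

lemma truncated_geometric_stochastic:
  assumes "0 < r"
  shows "stochastic_kernel {0..N} {0..N} (truncated_geometric r)"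
  unfolding stochastic_kernel_def distribution_on_def
proof (intro ballI conjI)
  fix x assume x: "x \<in> {0..N}"
  have Z: "0 < geom_sum r (x + 1)" using assms by (intro geom_sum_pos) auto
  then show "0 \<le> truncated_geometric r x z" for z
    using assms by (simp add: truncated_geometric_def)
  have "(\<Sum>z\<in>{0..N}. truncated_geometric r x z) = (\<Sum>z<x + 1. r ^ z / geom_sum r (x + 1))"
    using x by (intro sum.mono_neutral_cong_right) (auto simp: truncated_geometric_def)
  also have "\<dots> = 1"
    using Z by (simp add: sum_divide_distrib[symmetric] geom_sum_def)
  finally show "(\<Sum>z\<in>{0..N}. truncated_geometric r x z) = 1" .
qed

section \<open>Chains that move one coordinate at a time\<close>

text \<open>
  The matrix \<open>I + A \<otimes> I + I \<otimes> B\<close>.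
\<close>
definition product_walk ::
  "('a \<Rightarrow> 'a \<Rightarrow> real) \<Rightarrow> ('b \<Rightarrow> 'b \<Rightarrow> real) \<Rightarrow> 'a \<times> 'b \<Rightarrow> 'a \<times> 'b \<Rightarrow> real" where
  "product_walk A B = (\<lambda>(x, y) (x', y').
     of_bool (x = x' \<and> y = y') + A x x' * of_bool (y = y') + of_bool (x = x') * B y y')"

definition product_link ::
  "('a \<Rightarrow> 'b \<Rightarrow> real) \<Rightarrow> ('c \<Rightarrow> 'd \<Rightarrow> real) \<Rightarrow> 'a \<times> 'c \<Rightarrow> 'b \<times> 'd \<Rightarrow> real" where
  "product_link K L = (\<lambda>(x, y) (x', y'). K x x' * L y y')"

lemma product_walk_sum:
  assumes "finite S" "finite T" "x \<in> S" "y \<in> T"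
  shows "(\<Sum>g\<in>S \<times> T. product_walk A B (x, y) g * h g)
    = h (x, y) + (\<Sum>x'\<in>S. A x x' * h (x', y)) + (\<Sum>y'\<in>T. B y y' * h (x, y'))"
proof -
  have "(\<Sum>g\<in>S \<times> T. product_walk A B (x, y) g * h g)
     = (\<Sum>x'\<in>S. \<Sum>y'\<in>T. (if x = x' then if y = y' then h (x, y) else 0 else 0)
          + (if y = y' then A x x' * h (x', y') else 0) + (if x = x' then B y y' * h (x', y') else 0))"
    unfolding sum.cartesian_product'
    by (intro sum.cong refl) (auto simp: product_walk_def algebra_simps)
  also have "\<dots> = (\<Sum>x'\<in>S. \<Sum>y'\<in>T. if x = x' then if y = y' then h (x, y) else 0 else 0)
      + (\<Sum>x'\<in>S. A x x' * h (x', y))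
      + (\<Sum>x'\<in>S. \<Sum>y'\<in>T. if x = x' then B y y' * h (x', y') else 0)"
    using assms by (simp add: sum.distrib)
  also have "(\<Sum>x'\<in>S. \<Sum>y'\<in>T. if x = x' then if y = y' then h (x, y) else 0 else 0) = h (x, y)"
    using assms by (subst sum.swap) simp
  also have "(\<Sum>x'\<in>S. \<Sum>y'\<in>T. if x = x' then B y y' * h (x', y') else 0) = (\<Sum>y'\<in>T. B y y' * h (x, y'))"
    using assms by (subst sum.swap) simp
  finally show ?thesis .
qed

lemma product_walk_sum_left:
  assumes "finite S" "finite T" "x \<in> S" "y \<in> T"
  shows "(\<Sum>g\<in>S \<times> T. h g * product_walk A B g (x, y))
    = h (x, y) + (\<Sum>x'\<in>S. h (x', y) * A x' x) + (\<Sum>y'\<in>T. h (x, y') * B y' y)"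
proof -
  have "product_walk A B g (x, y) = product_walk (\<lambda>x z. A z x) (\<lambda>y z. B z y) (x, y) g" for g
    by (cases g) (auto simp: product_walk_def)
  then show ?thesis
    using product_walk_sum[OF assms, of "\<lambda>x z. A z x" "\<lambda>y z. B z y" h] by (simp add: mult.commute)
qed

lemma product_intertwining:
  assumes "finite S" "finite T" "finite S'" "finite T'"
    and "x' \<in> S'" "x \<in> S" "y' \<in> T'" "y \<in> T"
    and 1: "kernel_comp S K A x' x = kernel_comp S' A' K x' x"
    and 2: "kernel_comp T L B y' y = kernel_comp T' B' L y' y"
  shows "kernel_comp (S \<times> T) (product_link K L) (product_walk A B) (x', y') (x, y)
       = kernel_comp (S' \<times> T') (product_walk A' B') (product_link K L) (x', y') (x, y)"
proof -
  have "kernel_comp (S \<times> T) (product_link K L) (product_walk A B) (x', y') (x, y)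
      = K x' x * L y' y + kernel_comp S K A x' x * L y' y + K x' x * kernel_comp T L B y' y"
    unfolding kernel_comp_def using assms(1-8)
    by (subst product_walk_sum_left)
       (simp_all add: product_link_def sum_distrib_left sum_distrib_right mult_ac)
  also have "\<dots> = kernel_comp (S' \<times> T') (product_walk A' B') (product_link K L) (x', y') (x, y)"
    unfolding 1 2 unfolding kernel_comp_def using assms(1-8)
    by (subst product_walk_sum)
       (simp_all add: product_link_def sum_distrib_left sum_distrib_right mult_ac)
  finally show ?thesis .
qed

lemma product_link_stochastic:
  assumes "finite T'" "stochastic_kernel S S' K" "stochastic_kernel T T' L"
  shows "stochastic_kernel (S \<times> T) (S' \<times> T') (product_link K L)"
  using assms unfolding stochastic_kernel_def distribution_on_def
  by (auto simp: product_link_def sum.cartesian_product' sum_distrib_left[symmetric] sum_distrib_right[symmetric])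

lemma birth_death_product_nonneg:
  assumes "\<And>x. 0 \<le> u x" "\<And>x. 0 \<le> d x" "\<And>y. 0 \<le> u' y" "\<And>y. 0 \<le> d' y"
    and "u x + d x + u' y + d' y \<le> 1"
  shows "0 \<le> product_walk (birth_death_generator u d) (birth_death_generator u' d') (x, y) f"
  using assms by (cases f) (auto simp: product_walk_def birth_death_generator_def)

section \<open>The lattice walk and its dual\<close>

lemma lattice_walk_eq_product:
  assumes "e \<in> lattice_square N" "f \<in> lattice_square N"
  shows "lattice_walk N lam1 lam2 mu1 mu2 e f
    = product_walk (birth_death_generator (bd_up N lam1) (bd_down mu1))
        (birth_death_generator (bd_up N lam2) (bd_down mu2)) e f"
  using assms
  by (cases e; cases f)
    (auto simp: lattice_square_def lattice_walk_def product_walk_def birth_death_generator_def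
      bd_up_def bd_down_def)

text \<open>
  The product form covers all boundary cases at once: a coordinate that has reached \<open>N\<close> is frozen,
  and a coordinate below \<open>N\<close> leaves its value with probability \<open>\<lambda> + \<mu>\<close>.
\<close>
lemma lattice_dual_eq_product:
  assumes "lam1 > 0" "lam2 > 0" "mu1 > 0" "mu2 > 0" "lam1 \<noteq> mu1" "lam2 \<noteq> mu2"
    and "e \<in> lattice_square N" "f \<in> lattice_square N"
  shows "lattice_dual N lam1 lam2 mu1 mu2 e f
    = product_walk
        (birth_death_generator (dual_up N (lam1 / mu1) mu1) (dual_down N (lam1 / mu1) lam1))
        (birth_death_generator (dual_up N (lam2 / mu2) mu2) (dual_down N (lam2 / mu2) lam2)) e f"
proof -
  obtain x y x' y' where ef: "e = (x, y)" "f = (x', y')" by (cases e; cases f)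
  have le: "x \<le> N" "y \<le> N" "x' \<le> N" "y' \<le> N" using assms(7,8) by (auto simp: ef lattice_square_def)
  have ratio: "(1 - r ^ m) / (1 - r ^ n) = geom_sum r m / geom_sum r n" if "r \<noteq> 1" for r :: real and m n
    using that by (simp add: geom_sum_eq[symmetric])
  have rates: "dual_up N (lam / mu) mu x + dual_down N (lam / mu) lam x = (if x < N then lam + mu else 0)"
    if "0 < lam" "0 < mu" for lam mu x
    using dual_rates_sum[of "lam / mu" lam mu x N] that by (auto simp: dual_up_def dual_down_def)
  have ratio1: "(1 - (lam1 / mu1) ^ m) / (1 - (lam1 / mu1) ^ n)
      = geom_sum (lam1 / mu1) m / geom_sum (lam1 / mu1) n" for m n
    using assms by (intro ratio) simp
  have ratio2: "(1 - (lam2 / mu2) ^ m) / (1 - (lam2 / mu2) ^ n)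
      = geom_sum (lam2 / mu2) m / geom_sum (lam2 / mu2) n" for m n
    using assms by (intro ratio) simp
  show ?thesis
    using assms(1-4) le
    unfolding ef lattice_dual_def Let_def ratio1 ratio2 product_walk_def birth_death_generator_def
    by (simp add: rates) (auto simp: dual_up_def dual_down_def)
qed

lemma birth_death_product_row_sum:
  assumes "u N = 0" "d 0 = 0" "u' N = 0" "d' 0 = 0" "e \<in> lattice_square N"
  shows "(\<Sum>f\<in>lattice_square N.
      product_walk (birth_death_generator u d) (birth_death_generator u' d') e f) = 1"
proof -
  obtain x y where e: "e = (x, y)" "x \<le> N" "y \<le> N"
    using assms(5) by (auto simp: lattice_square_def)
  show ?thesis
    using product_walk_sum[of "{0..N}" "{0..N}" x y "birth_death_generator u d"
        "birth_death_generator u' d'" "\<lambda>_. 1"]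
      birth_death_generator_apply[of x N u d "\<lambda>_. 1"]
      birth_death_generator_apply[of y N u' d' "\<lambda>_. 1"] assms e
    by (simp add: lattice_square_def)
qed

lemma lattice_dual_stochastic:
  assumes pos: "lam1 > 0" "lam2 > 0" "mu1 > 0" "mu2 > 0" and ne: "lam1 \<noteq> mu1" "lam2 \<noteq> mu2"
    and le: "lam1 + lam2 + mu1 + mu2 \<le> 1"
  shows "stochastic_kernel (lattice_square N) (lattice_square N) (lattice_dual N lam1 lam2 mu1 mu2)"
  unfolding stochastic_kernel_def distribution_on_def
proof (intro ballI conjI)
  fix e assume e: "e \<in> lattice_square N"
  note eq = lattice_dual_eq_product[OF pos ne]
  have nonneg: "0 \<le> geom_sum r n" if "0 < r" for r n
    using geom_sum_pos[OF that, of n] by (cases n) (auto simp: geom_sum_simps(1))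
  have up: "0 \<le> dual_up N (lam / mu) mu x" and down: "0 \<le> dual_down N (lam / mu) lam x"
    and total: "dual_up N (lam / mu) mu x + dual_down N (lam / mu) lam x \<le> lam + mu"
    if "0 < lam" "0 < mu" for lam mu x
    using that nonneg[of "lam / mu"] dual_rates_sum[of "lam / mu" lam mu x N]
    by (auto simp: dual_up_def dual_down_def)
  show "0 \<le> lattice_dual N lam1 lam2 mu1 mu2 e f" if "f \<in> lattice_square N" for f
  proof -
    obtain x y where xy: "e = (x, y)" by (cases e)
    show ?thesis
      unfolding eq[OF e that] unfolding xy
      by (rule birth_death_product_nonneg)
         (use up down pos total[of lam1 mu1 x] total[of lam2 mu2 y] le in auto)
  qed
  show "(\<Sum>f\<in>lattice_square N. lattice_dual N lam1 lam2 mu1 mu2 e f) = 1"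
    using birth_death_product_row_sum[OF _ _ _ _ e] eq[OF e]
    by (simp add: dual_up_def dual_down_def geom_sum_simps(1))
qed

text \<open>
  Steps to neighbours have positive probability in both directions, which gives irreducibility
  through the corner \<open>(0, 0)\<close>. There the downward steps are suppressed, so the holding probability
  is at least \<open>\<mu>\<^sub>1 + \<mu>\<^sub>2 > 0\<close>; this excludes periodicity even when the four rates add up to \<open>1\<close>.
\<close>
lemma lattice_walk_ergodic:
  assumes pos: "lam1 > 0" "lam2 > 0" "mu1 > 0" "mu2 > 0"
    and le: "lam1 + lam2 + mu1 + mu2 \<le> 1"
    and P: "stochastic_kernel (lattice_square N) (lattice_square N) (lattice_walk N lam1 lam2 mu1 mu2)"
  shows "ergodic_kernel (lattice_square N) (lattice_walk N lam1 lam2 mu1 mu2)"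
proof -
  let ?S = "lattice_square N" and ?P = "lattice_walk N lam1 lam2 mu1 mu2"
  let ?R = "\<lambda>e f. e \<in> ?S \<and> f \<in> ?S \<and> 0 < ?P e f"
  have S: "finite ?S" by (simp add: lattice_square_def)
  have right: "?R (x, y) (Suc x, y)" "?R (Suc x, y) (x, y)" if "x < N" "y \<le> N" for x y
    using that pos by (auto simp: lattice_walk_def lattice_square_def)
  have up: "?R (x, y) (x, Suc y)" "?R (x, Suc y) (x, y)" if "x \<le> N" "y < N" for x y
    using that pos by (auto simp: lattice_walk_def lattice_square_def)
  have row: "?R\<^sup>*\<^sup>* (0, 0) (x, 0) \<and> ?R\<^sup>*\<^sup>* (x, 0) (0, 0)" if "x \<le> N" for x
    using that
  proof (induction x)
    case (Suc x)
    then show ?case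
      using right[of x 0] rtranclp.rtrancl_into_rtrancl[of ?R "(0, 0)" "(x, 0)"]
        converse_rtranclp_into_rtranclp[of ?R "(Suc x, 0)" "(x, 0)"] by auto
  qed simp
  have all: "?R\<^sup>*\<^sup>* (0, 0) (x, y) \<and> ?R\<^sup>*\<^sup>* (x, y) (0, 0)" if "x \<le> N" "y \<le> N" for x y
    using that(2)
  proof (induction y)
    case 0
    then show ?case using row[OF that(1)] by simp
  next
    case (Suc y)
    then show ?case
      using that(1) up[of x y] rtranclp.rtrancl_into_rtrancl[of ?R "(0, 0)" "(x, y)"]
        converse_rtranclp_into_rtranclp[of ?R "(x, Suc y)" "(x, y)"] by auto
  qed
  have irr: "irreducible_kernel ?S ?P"
    unfolding irreducible_kernel_def
  proof (intro ballI)
    fix e f assume ef: "e \<in> ?S" "f \<in> ?S"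
    then have "?R\<^sup>*\<^sup>* e (0, 0)" "?R\<^sup>*\<^sup>* (0, 0) f"
      using all by (auto simp: lattice_square_def)
    then have "?R\<^sup>*\<^sup>* e f" by (rule rtranclp_trans)
    then show "\<exists>n. 0 < kernel_pow ?S ?P n e f" using kernel_pow_reachable[OF P S] ef by blast
  qed
  moreover have "aperiodic_kernel ?S ?P"
    by (rule aperiodic_of_loop[OF P S irr, of "(0, 0)"])
       (use pos le in \<open>auto simp: lattice_square_def lattice_walk_def\<close>)
  ultimately show ?thesis by (simp add: ergodic_kernel_def)
qed

lemma lattice_dual_absorbing_state_iff:
  assumes "lam1 > 0" "lam2 > 0" "mu1 > 0" "mu2 > 0" "e \<in> lattice_square N"
  shows "absorbing_state (lattice_dual N lam1 lam2 mu1 mu2) e \<longleftrightarrow> e = (N, N)"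
  using assms by (cases e) (auto simp: absorbing_state_def lattice_dual_def lattice_square_def Let_def)

lemma lattice_dual_absorbing_kernel:
  assumes pos: "lam1 > 0" "lam2 > 0" "mu1 > 0" "mu2 > 0" and ne: "lam1 \<noteq> mu1" "lam2 \<noteq> mu2"
    and le: "lam1 + lam2 + mu1 + mu2 \<le> 1"
  shows "absorbing_kernel (lattice_square N) (lattice_dual N lam1 lam2 mu1 mu2)"
  unfolding absorbing_kernel_def
proof
  let ?S = "lattice_square N" and ?P = "lattice_dual N lam1 lam2 mu1 mu2"
  let ?R = "\<lambda>e f. e \<in> ?S \<and> f \<in> ?S \<and> 0 < ?P e f"
  have S: "finite ?S" and a: "(N, N) \<in> ?S" by (auto simp: lattice_square_def)
  have up: "0 < dual_up N (lam / mu) mu x" if "0 < lam" "0 < mu" "x < N" for lam mu x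
    using that geom_sum_pos[of "lam / mu"] by (simp add: dual_up_def)
  have right: "?R (x, y) (Suc x, y)" if "x < N" "y \<le> N" for x y
    using that pos up[of lam1 mu1 x] lattice_dual_eq_product[OF pos ne, of "(x, y)" N "(Suc x, y)"]
    by (auto simp: lattice_square_def product_walk_def birth_death_generator_def)
  have top: "?R (x, y) (x, Suc y)" if "x \<le> N" "y < N" for x y
    using that pos up[of lam2 mu2 y] lattice_dual_eq_product[OF pos ne, of "(x, y)" N "(x, Suc y)"]
    by (auto simp: lattice_square_def product_walk_def birth_death_generator_def)
  fix e assume e: "e \<in> ?S"
  obtain x y where xy: "e = (x, y)" "x \<le> N" "y \<le> N" using e by (auto simp: lattice_square_def)
  have "?R\<^sup>*\<^sup>* (x, y) (N, y)"
    using xy(2) by (rule inc_induct) (use right xy(3) in \<open>auto intro: converse_rtranclp_into_rtranclp\<close>)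
  also have "?R\<^sup>*\<^sup>* (N, y) (N, N)"
    using xy(3) by (rule inc_induct) (use top in \<open>auto intro: converse_rtranclp_into_rtranclp\<close>)
  finally have "\<exists>n. 0 < kernel_pow ?S ?P n e (N, N)"
    using kernel_pow_reachable[OF lattice_dual_stochastic[OF pos ne le] S _ e] xy(1) by blast
  then show "\<exists>b\<in>?S. absorbing_state ?P b \<and> (\<exists>n. 0 < kernel_pow ?S ?P n e b)"
    using a lattice_dual_absorbing_state_iff[OF pos a] by blast
qed

abbreviation lattice_link :: "real \<Rightarrow> real \<Rightarrow> nat \<times> nat \<Rightarrow> nat \<times> nat \<Rightarrow> real" where
  "lattice_link r1 r2 \<equiv> product_link (truncated_geometric r1) (truncated_geometric r2)"

lemma lattice_link_top:
  assumes "r1 \<noteq> 1" "r2 \<noteq> 1" "e \<in> lattice_square N"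
  shows "lattice_link r1 r2 (N, N) e = lattice_stationary N r1 r2 e"
  using assms
  by (cases e) (auto simp: product_link_def truncated_geometric_def lattice_stationary_def
      lattice_square_def geom_sum_eq simp del: power_Suc)

lemma lattice_intertwining:
  assumes pos: "lam1 > 0" "lam2 > 0" "mu1 > 0" "mu2 > 0" and ne: "lam1 \<noteq> mu1" "lam2 \<noteq> mu2"
    and S: "e \<in> lattice_square N" "f \<in> lattice_square N"
  shows "kernel_comp (lattice_square N) (lattice_link (lam1 / mu1) (lam2 / mu2))
           (lattice_walk N lam1 lam2 mu1 mu2) e f
       = kernel_comp (lattice_square N) (lattice_dual N lam1 lam2 mu1 mu2)
           (lattice_link (lam1 / mu1) (lam2 / mu2)) e f"
proof -
  obtain x y x' y' where xy: "e = (x, y)" "f = (x', y')" "x \<le> N" "y \<le> N" "x' \<le> N" "y' \<le> N"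
    using S by (auto simp: lattice_square_def)
  have "kernel_comp (lattice_square N) (lattice_link (lam1 / mu1) (lam2 / mu2))
      (lattice_walk N lam1 lam2 mu1 mu2) e f
    = kernel_comp (lattice_square N) (lattice_link (lam1 / mu1) (lam2 / mu2))
      (product_walk (birth_death_generator (bd_up N lam1) (bd_down mu1))
        (birth_death_generator (bd_up N lam2) (bd_down mu2))) e f"
    using S by (simp add: kernel_comp_def lattice_walk_eq_product)
  also have "\<dots> = kernel_comp (lattice_square N) (product_walk
        (birth_death_generator (dual_up N (lam1 / mu1) mu1) (dual_down N (lam1 / mu1) lam1))
        (birth_death_generator (dual_up N (lam2 / mu2) mu2) (dual_down N (lam2 / mu2) lam2)))
      (lattice_link (lam1 / mu1) (lam2 / mu2)) e f"
    unfolding lattice_square_def xy(1,2)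
    by (rule product_intertwining) (use pos xy in \<open>auto intro!: birth_death_intertwining\<close>)
  also have "\<dots> = kernel_comp (lattice_square N) (lattice_dual N lam1 lam2 mu1 mu2)
      (lattice_link (lam1 / mu1) (lam2 / mu2)) e f"
    using S by (simp add: kernel_comp_def lattice_dual_eq_product[OF pos ne])
  finally show ?thesis .
qed

theorem theorem3p2:
  fixes N :: nat and lam1 lam2 mu1 mu2 rho1 rho2 :: real
    and M :: "'w measure" and X :: "nat \<Rightarrow> 'w \<Rightarrow> nat \<times> nat"
  assumes "N \<ge> 1"
    and "lam1 > 0" and "lam2 > 0" and "mu1 > 0" and "mu2 > 0"
    and "lam1 \<noteq> mu1" and "lam2 \<noteq> mu2"
    and "lam1 + lam2 + mu1 + mu2 \<le> 1"
    and "rho1 = lam1 / mu1" and "rho2 = lam2 / mu2"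
    and "markov_chain M X (lattice_square N) (point_mass (0, 0))
           (lattice_walk N lam1 lam2 mu1 mu2)"
  shows "\<exists>(M' :: (nat \<Rightarrow> nat \<times> nat) measure) (Y :: nat \<Rightarrow> (nat \<Rightarrow> nat \<times> nat) \<Rightarrow> nat \<times> nat).
           sharp_strong_stationary_dual
             M X (lattice_square N) (point_mass (0, 0)) (lattice_walk N lam1 lam2 mu1 mu2)
               (lattice_stationary N rho1 rho2)
             M' Y (lattice_square N) (point_mass (0, 0)) (lattice_dual N lam1 lam2 mu1 mu2) (N, N)
           \<and> absorbing_kernel (lattice_square N) (lattice_dual N lam1 lam2 mu1 mu2)
           \<and> {e \<in> lattice_square N. absorbing_state (lattice_dual N lam1 lam2 mu1 mu2) e} = {(N, N)}"
proof -
  let ?S = "lattice_square N" and ?v = "point_mass (0, 0) :: nat \<times> nat \<Rightarrow> real"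
    and ?P = "lattice_walk N lam1 lam2 mu1 mu2" and ?P' = "lattice_dual N lam1 lam2 mu1 mu2"
    and ?p = "lattice_stationary N rho1 rho2" and ?L = "lattice_link rho1 rho2"
  note pos = assms(2-5) and ne = assms(6,7) and le = assms(8) and X = assms(11)
  have r: "0 < rho1" "0 < rho2" "rho1 \<noteq> 1" "rho2 \<noteq> 1"
    using pos ne by (auto simp: assms(9,10))
  have S: "finite ?S" and a: "(N, N) \<in> ?S" and o: "(0, 0) \<in> ?S"
    by (auto simp: lattice_square_def)
  have P: "stochastic_kernel ?S ?S ?P" and v: "distribution_on ?S ?v"
    using X by (auto simp: markov_chain_def)
  have P': "stochastic_kernel ?S ?S ?P'"
    using lattice_dual_stochastic[OF pos ne le] .
  obtain M' :: "(nat \<Rightarrow> nat \<times> nat) measure" where Y: "markov_chain M' (\<lambda>n w. w n) ?S ?v ?P'"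
    using canonical_markov_chain_exists[OF S v P'] by blast
  have absorbing: "absorbing_state ?P' (N, N)"
    using lattice_dual_absorbing_state_iff[OF pos a] by simp
  have L: "stochastic_kernel ?S ?S ?L"
    unfolding lattice_square_def using r
    by (intro product_link_stochastic truncated_geometric_stochastic) auto
  have top: "\<forall>e\<in>?S. ?L (N, N) e = ?p e"
    using lattice_link_top r by blast
  have init: "\<forall>e\<in>?S. ?v e = vec_kernel ?S ?v ?L e"
  proof
    fix e assume e: "e \<in> ?S"
    have "vec_kernel ?S ?v ?L e = (\<Sum>g\<in>?S. if g = (0, 0) then ?L (0, 0) e else 0)"
      unfolding vec_kernel_def by (intro sum.cong) (auto simp: point_mass_def)
    also have "\<dots> = ?L (0, 0) e" using S o by simp
    \<comment> \<open>Row \<open>(0, 0)\<close> of the link is conditioned on a single point.\<close>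
    also have "\<dots> = ?v e"
      by (cases e) (auto simp: product_link_def truncated_geometric_def point_mass_def geom_sum_def)
    finally show "?v e = vec_kernel ?S ?v ?L e" by simp
  qed
  have int: "\<forall>e'\<in>?S. \<forall>e\<in>?S. kernel_comp ?S ?L ?P e' e = kernel_comp ?S ?P' ?L e' e"
    using lattice_intertwining[OF pos ne] by (simp add: assms(9,10))
  have p_pos: "\<forall>e\<in>?S. 0 < ?p e"
  proof
    fix e assume e: "e \<in> ?S"
    have "0 < ?L (N, N) e"
      using e r geom_sum_pos[of _ "N + 1"]
      by (cases e) (auto simp: product_link_def truncated_geometric_def lattice_square_def)
    then show "0 < ?p e" using top e by simp
  qed
  have witness: "\<forall>e'\<in>?S - {(N, N)}. ?L e' (N, N) = 0"
    by (auto simp: product_link_def truncated_geometric_def lattice_square_def split: if_splits)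
  have "sharp_strong_stationary_dual M X ?S ?v ?P ?p M' (\<lambda>n w. w n) ?S ?v ?P' (N, N)"
    by (rule sharp_dual_of_witness_state[OF X lattice_walk_ergodic[OF pos le P] Y a absorbing L top
          init int p_pos a witness])
  moreover have "absorbing_kernel ?S ?P'"
    using lattice_dual_absorbing_kernel[OF pos ne le] .
  moreover have "{e \<in> ?S. absorbing_state ?P' e} = {(N, N)}"
    using lattice_dual_absorbing_state_iff[OF pos] a by blast
  ultimately show ?thesis by blast
qed

end
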